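(* Let $L_1,L_2,L_3$ be three noncoplanar lines in $\mathbb{P}^3$ (over $\mathbb{C}$) concurrent at a point $O$. Let $Z=\{P_1,P_2,P_3,Q_1,Q_2,Q_3\}$ be a set of six points in $\mathbb{P}^3\setminus\{O\}$, with $P_i,Q_i\in L_i$ for $i=1,2,3$. For each $i$ let $H_i\in L_i$ be the harmonic conjugate of $O$ with respect to $P_i,Q_i$. Then the Weddle surface of $Z$ is the union of the four planes $$\mathcal{W}(Z)=\langle L_1,L_2\rangle\ \cup\ \langle L_1,L_3\rangle\ \cup\ \langle L_2,L_3\rangle\ \cup\ \langle H_1,H_2,H_3\rangle .$$
   Context: $\langle\cdot\rangle$ denotes linear span. $H_i$ being the harmonic conjugate of $O$ with respect to $P_i,Q_i$ means that the cross-ratio $(O,H_i;P_i,Q_i)$ equals $-1$. For a set $Z$ of six points in $\mathbb{P}^3$ and $P\in\mathbb{P}^3\setminus Z$, let $\delta(P)=\dim_{\mathbb{C}}[I(Z)\cap I(P)^2]_2$, the dimension of the space of quadric cones with vertex $P$ containing $Z$ (equivalently, of conics containing the projection of $Z$ from $P$ to a plane). The Weddle surface $\mathcal{W}(Z)$ is the $2$-Weddle locus of $Z$: the Zariski closure of the set of $P\in\mathbb{P}^3\setminus Z$ at which $\delta(P)$ exceeds its minimal (generic) value. *)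

theory Defs
  imports "HOL-Analysis.Analysis" "HOL-Library.Poly_Mapping"
begin

text \<open>Points are the one-dimensional linear subspaces of \<open>\<complex>\<^sup>4\<close>; \<open>vec\<close> is the library's
  interpretation of linear algebra over the scalars of the vector, here \<open>\<complex>\<close> rather than \<open>\<real>\<close>.\<close>

typedef proj3 = "{l :: (complex ^ 4) set. vec.subspace l \<and> vec.dim l = 1}"
  morphisms ray Abs_proj3
proof
  have "vec.independent {axis 1 1 :: complex ^ 4}"
    by (simp add: vec.dependent_single)
  then have "vec.dim (vec.span {axis 1 1 :: complex ^ 4}) = 1"
    by (simp add: vec.dim_span vec.dim_eq_card_independent)
  then show "vec.span {axis 1 1 :: complex ^ 4} \<in> {l. vec.subspace l \<and> vec.dim l = 1}"
    by simp
qed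

definition proj_subspace :: "nat \<Rightarrow> proj3 set \<Rightarrow> bool" where
  "proj_subspace d S \<longleftrightarrow>
     (\<exists>W. vec.subspace W \<and> vec.dim W = d + 1 \<and> S = {p. ray p \<subseteq> W})"

abbreviation is_line :: "proj3 set \<Rightarrow> bool" where
  "is_line \<equiv> proj_subspace 1"

abbreviation is_plane :: "proj3 set \<Rightarrow> bool" where
  "is_plane \<equiv> proj_subspace 2"

definition lin_span :: "proj3 set \<Rightarrow> proj3 set" where
  "lin_span S = {p. ray p \<subseteq> vec.span (\<Union>q\<in>S. ray q)}"

definition bracket :: "complex ^ 2 \<Rightarrow> complex ^ 2 \<Rightarrow> complex" where
  "bracket x y = x $ 1 * y $ 2 - x $ 2 * y $ 1"

text \<open>\<open>x\<close> is a vector of homogeneous coordinates of \<open>A\<close> on the line spanned by \<open>u\<close>, \<open>v\<close>.\<close>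

definition line_coords :: "complex ^ 4 \<Rightarrow> complex ^ 4 \<Rightarrow> proj3 \<Rightarrow> complex ^ 2 \<Rightarrow> bool" where
  "line_coords u v A x \<longleftrightarrow> x \<noteq> 0 \<and> ray A = vec.span {x $ 1 *s u + x $ 2 *s v}"

text \<open>In an affine coordinate this is \<open>(A,B;C,D) = ((A-C)(B-D)) / ((B-C)(A-D))\<close>.
  It is a relation because the cross-ratio is only defined for collinear points and takes the
  value infinity when \<open>B = C\<close> or \<open>A = D\<close>; the bracket conditions restrict it to finite values.\<close>

definition has_cross_ratio :: "proj3 \<Rightarrow> proj3 \<Rightarrow> proj3 \<Rightarrow> proj3 \<Rightarrow> complex \<Rightarrow> bool" where
  "has_cross_ratio A B C D k \<longleftrightarrow>
     (\<exists>u v a b c d. u \<noteq> v \<and> vec.independent {u, v} \<and>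
        line_coords u v A a \<and> line_coords u v B b \<and>
        line_coords u v C c \<and> line_coords u v D d \<and>
        bracket b c \<noteq> 0 \<and> bracket a d \<noteq> 0 \<and>
        k = (bracket a c * bracket b d) / (bracket b c * bracket a d))"

definition harmonic_conjugate :: "proj3 \<Rightarrow> proj3 \<Rightarrow> proj3 \<Rightarrow> proj3 \<Rightarrow> bool" where
  "harmonic_conjugate H A P Q \<longleftrightarrow> has_cross_ratio A H P Q (-1)"

text \<open>The polynomial ring in four variables over \<open>\<complex>\<close>, indexed by the four coordinates; an
  element of \<open>4 \<Rightarrow>\<^sub>0 nat\<close> is the exponent vector of a monomial.\<close>

type_synonym cpoly = "(4 \<Rightarrow>\<^sub>0 nat) \<Rightarrow>\<^sub>0 complex"

definition peval :: "cpoly \<Rightarrow> complex ^ 4 \<Rightarrow> complex" where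
  "peval f x = (\<Sum>m\<in>Poly_Mapping.keys f.
     Poly_Mapping.lookup f m * (\<Prod>i\<in>UNIV. x $ i ^ Poly_Mapping.lookup m i))"

definition homogeneous :: "nat \<Rightarrow> cpoly \<Rightarrow> bool" where
  "homogeneous d f \<longleftrightarrow>
     (\<forall>m\<in>Poly_Mapping.keys f. (\<Sum>i\<in>UNIV. Poly_Mapping.lookup m i) = d)"

text \<open>Vanishing on every vector of the lines in \<open>S\<close> means, since \<open>\<complex>\<close> is infinite, that every
  homogeneous component vanishes at the points of \<open>S\<close>: this is the homogeneous ideal of \<open>S\<close>.\<close>

definition vanishing_ideal :: "proj3 set \<Rightarrow> cpoly set" where
  "vanishing_ideal S = {f. \<forall>p\<in>S. \<forall>x\<in>ray p. peval f x = 0}"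

definition zero_locus :: "cpoly set \<Rightarrow> proj3 set" where
  "zero_locus I = {p. \<forall>f\<in>I. \<forall>x\<in>ray p. peval f x = 0}"

definition zariski_closure :: "proj3 set \<Rightarrow> proj3 set" where
  "zariski_closure S = zero_locus (vanishing_ideal S)"

definition ideal_mult :: "cpoly set \<Rightarrow> cpoly set \<Rightarrow> cpoly set" where
  "ideal_mult I J =
     {\<Sum>i<n. f i * g i | (n::nat) f g. \<forall>i<n. f i \<in> I \<and> g i \<in> J}"

definition graded_part :: "nat \<Rightarrow> cpoly set \<Rightarrow> cpoly set" where
  "graded_part d I = {f\<in>I. homogeneous d f}"

definition cscale :: "complex \<Rightarrow> cpoly \<Rightarrow> cpoly" where
  "cscale c f = Poly_Mapping.single 0 c * f"

interpretation cpoly: vector_space cscale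
  by standard
    (simp_all add: cscale_def algebra_simps single_add mult_single flip: mult.assoc)

text \<open>The square of \<open>I(P)\<close> is the ideal product, so its quadrics are those singular at \<open>P\<close>,
  i.e. the quadric cones with vertex \<open>P\<close>.\<close>

definition cone_dim :: "proj3 set \<Rightarrow> proj3 \<Rightarrow> nat" where
  "cone_dim Z P = cpoly.dim (graded_part 2
     (vanishing_ideal Z \<inter> ideal_mult (vanishing_ideal {P}) (vanishing_ideal {P})))"

text \<open>The infimum is over natural numbers, hence is attained whenever \<open>Z\<close> is not all of the
  space.\<close>

definition weddle_locus :: "proj3 set \<Rightarrow> proj3 set" where
  "weddle_locus Z =
     zariski_closure {P \<in> UNIV - Z. cone_dim Z P > (INF Q\<in>UNIV - Z. cone_dim Z Q)}"

end

theory Submission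
  imports Defs "HOL-Computational_Algebra.Polynomial"
begin

text \<open>
  The harmonic condition is what makes the configuration symmetric. If \<open>O\<close> is spanned by \<open>e\<close>, then
  vectors \<open>h\<^sub>i\<close> spanning the points \<open>H\<^sub>i\<close> can be scaled so that \<open>P\<^sub>i\<close> and \<open>Q\<^sub>i\<close> are spanned by
  \<open>h\<^sub>i + e\<close> and \<open>h\<^sub>i - e\<close> (\<open>harmonic_representatives\<close>), and \<open>h\<^sub>1, h\<^sub>2, h\<^sub>3, e\<close> is a basis
  because the lines are not coplanar. The four planes of the theorem are the coordinate planes
  \<open>x\<^sub>k = 0\<close> of this basis.

  The quadratic form of a symmetric bilinear form \<open>B\<close> vanishes at both \<open>h\<^sub>i \<plusminus> e\<close> exactly when \<open>B(h\<^sub>i, e) = 0\<close> and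
  \<open>B(h\<^sub>i, h\<^sub>i) = - B(e, e)\<close>. So the quadrics through the six points are
  \<open>a (x\<^sub>1\<^sup>2 + x\<^sub>2\<^sup>2 + x\<^sub>3\<^sup>2 - x\<^sub>4\<^sup>2) + 2 (b\<^sub>1\<^sub>2 x\<^sub>1 x\<^sub>2 + b\<^sub>1\<^sub>3 x\<^sub>1 x\<^sub>3 + b\<^sub>2\<^sub>3 x\<^sub>2 x\<^sub>3)\<close>. Being singular at a given
  point \<open>x\<close> is a system of four linear equations for the four coefficients, with determinant
  \<open>x\<^sub>1 x\<^sub>2 x\<^sub>3 x\<^sub>4\<close> up to a nonzero constant. Hence the generic value of \<open>\<delta>\<close> is \<open>0\<close>, and it jumps
  exactly on the coordinate planes.

  For points off the planes the equations are solved directly (\<open>cone_dim_off_faces\<close>). That step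
  needs members of \<open>I(P)\<^sup>2\<close> to be singular at \<open>P\<close>. For points on the planes, membership in
  \<open>I(P)\<^sup>2\<close> must be exhibited, so cones are written down as sums of products of linear forms
  vanishing at \<open>P\<close> (\<open>cone_dim_on_face_through_vertex\<close>, \<open>cone_dim_on_harmonic_face\<close>).

  The six points themselves are excluded from the jump locus, but each one is the limit of the
  other points of a line in one of the planes, so the Zariski closure puts them back
  (\<open>closure_faces_minus_Z\<close>).
\<close>

section \<open>Evaluation of polynomials and quadratic forms\<close>

lemma peval_superset:
  assumes "finite A" "Poly_Mapping.keys f \<subseteq> A"
  shows "peval f x =
    (\<Sum>m\<in>A. Poly_Mapping.lookup f m * (\<Prod>i\<in>UNIV. x $ i ^ Poly_Mapping.lookup m i))"
  unfolding peval_def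
  by (rule sum.mono_neutral_left) (use assms in \<open>auto simp: in_keys_iff\<close>)

lemma peval_zero [simp]: "peval 0 x = 0"
  by (simp add: peval_def)

lemma peval_add: "peval (f + g) x = peval f x + peval g x"
proof -
  let ?A = "Poly_Mapping.keys f \<union> Poly_Mapping.keys g"
  have "Poly_Mapping.keys (f + g) \<subseteq> ?A" by (rule Poly_Mapping.keys_add)
  then show ?thesis
    by (simp add: peval_superset[of ?A] lookup_add distrib_right sum.distrib)
qed

lemma peval_sum: "peval (\<Sum>a\<in>A. f a) x = (\<Sum>a\<in>A. peval (f a) x)"
  by (induction A rule: infinite_finite_induct) (simp_all add: peval_add)

lemma peval_single:
  "peval (Poly_Mapping.single m k) x = k * (\<Prod>i\<in>UNIV. x $ i ^ Poly_Mapping.lookup m i)"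
  by (simp add: peval_def)

lemma cpoly_eq_sum_single:
  fixes f :: cpoly
  shows "f = (\<Sum>m\<in>Poly_Mapping.keys f. Poly_Mapping.single m (Poly_Mapping.lookup f m))"
  by (rule poly_mapping_eqI)
    (auto simp: lookup_sum lookup_single when_def in_keys_iff)

lemma peval_mult: "peval (f * g) x = peval f x * peval g x"
proof -
  let ?s = "\<lambda>h m. Poly_Mapping.single m (Poly_Mapping.lookup h m)"
  have single: "peval (?s f m * ?s g n) x = peval (?s f m) x * peval (?s g n) x" for m n
    by (simp add: mult_single peval_single lookup_add power_add prod.distrib)
  have "f * g = (\<Sum>m\<in>Poly_Mapping.keys f. ?s f m) * (\<Sum>n\<in>Poly_Mapping.keys g. ?s g n)"
    by (simp flip: cpoly_eq_sum_single)
  also have "peval \<dots> x =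
      peval (\<Sum>m\<in>Poly_Mapping.keys f. ?s f m) x * peval (\<Sum>n\<in>Poly_Mapping.keys g. ?s g n) x"
    unfolding sum_product peval_sum single ..
  finally show ?thesis
    by (simp flip: cpoly_eq_sum_single)
qed

text \<open>Restricting to a line reduces limits and derivatives to statements about roots of univariate
  polynomials: infinitely many roots force vanishing, a double root kills the linear
  coefficient.\<close>

lemma peval_along_line:
  fixes x v :: "complex ^ 4"
  obtains q where "\<And>t. peval f (x + t *s v) = poly q t"
proof
  show "peval f (x + t *s v) =
      poly (\<Sum>m\<in>Poly_Mapping.keys f. smult (Poly_Mapping.lookup f m)
        (\<Prod>i\<in>UNIV. [:x $ i, v $ i:] ^ Poly_Mapping.lookup m i)) t" for t
    by (simp add: peval_def poly_sum poly_prod)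
qed

definition linear_form :: "complex ^ 4 \<Rightarrow> cpoly" where
  "linear_form c = (\<Sum>i\<in>UNIV. Poly_Mapping.single (Poly_Mapping.single i 1) (c $ i))"

definition dual :: "complex ^ 4 \<Rightarrow> complex ^ 4 \<Rightarrow> complex" where
  "dual c x = (\<Sum>i\<in>UNIV. c $ i * x $ i)"

lemma dual_simps [simp]:
  "dual c (x + y) = dual c x + dual c y" "dual c (x - y) = dual c x - dual c y"
  "dual c (k *s x) = k * dual c x" "dual c 0 = 0"
  "dual (c + d) x = dual c x + dual d x" "dual (c - d) x = dual c x - dual d x"
  "dual (k *s c) x = k * dual c x"
  by (simp_all add: dual_def algebra_simps sum.distrib sum_distrib_left sum_subtractf)

lemma peval_linear_form [simp]: "peval (linear_form c) x = dual c x"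
proof -
  have "(\<Prod>j\<in>UNIV. x $ j ^ (Poly_Mapping.lookup (Poly_Mapping.single i 1) j)) = x $ i" for i
  proof -
    have "(\<Prod>j\<in>UNIV. x $ j ^ (Poly_Mapping.lookup (Poly_Mapping.single i 1) j)) =
        (\<Prod>j\<in>UNIV. if j = i then x $ j else 1)"
      by (rule prod.cong) (auto simp: lookup_single when_def)
    then show ?thesis by simp
  qed
  then show ?thesis
    by (simp add: linear_form_def dual_def peval_sum peval_single)
qed

lemma homogeneous_zero: "homogeneous d 0"
  by (simp add: homogeneous_def)

lemma homogeneous_add: "homogeneous d f \<Longrightarrow> homogeneous d g \<Longrightarrow> homogeneous d (f + g)"
  unfolding homogeneous_def using Poly_Mapping.keys_add[of f g] by blast

lemma homogeneous_sum:
  "(\<And>a. a \<in> A \<Longrightarrow> homogeneous d (f a)) \<Longrightarrow> homogeneous d (\<Sum>a\<in>A. f a)"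
  by (induction A rule: infinite_finite_induct) (auto intro: homogeneous_zero homogeneous_add)

lemma homogeneous_mult:
  assumes "homogeneous d f" "homogeneous e g"
  shows "homogeneous (d + e) (f * g)"
  unfolding homogeneous_def
proof
  fix m assume "m \<in> Poly_Mapping.keys (f * g)"
  then obtain a b where "a \<in> Poly_Mapping.keys f" "b \<in> Poly_Mapping.keys g" "m = a + b"
    using keys_mult[of f g] by blast
  then show "(\<Sum>i\<in>UNIV. Poly_Mapping.lookup m i) = d + e"
    using assms by (simp add: homogeneous_def lookup_add sum.distrib)
qed

lemma homogeneous_linear_form: "homogeneous 1 (linear_form c)"
  unfolding linear_form_def
  by (rule homogeneous_sum) (simp add: homogeneous_def lookup_single when_def)

lemma homogeneous_linear_form_mult: "homogeneous 2 (linear_form c * linear_form d)"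
  using homogeneous_mult[OF homogeneous_linear_form homogeneous_linear_form] by (simp add: numeral_2_eq_2)

abbreviation mon2 :: "4 \<Rightarrow> 4 \<Rightarrow> 4 \<Rightarrow>\<^sub>0 nat" where
  "mon2 i j \<equiv> Poly_Mapping.single i 1 + Poly_Mapping.single j 1"

lemma degree_Suc_monomial:
  fixes m :: "4 \<Rightarrow>\<^sub>0 nat"
  assumes "(\<Sum>i\<in>UNIV. Poly_Mapping.lookup m i) = Suc d"
  obtains a n where "m = Poly_Mapping.single a 1 + n" "(\<Sum>i\<in>UNIV. Poly_Mapping.lookup n i) = d"
proof -
  obtain a where a: "Poly_Mapping.lookup m a \<noteq> 0"
    using assms by (metis nat.simps(3) sum.neutral)
  define n where "n = m - Poly_Mapping.single a 1"
  have m: "m = Poly_Mapping.single a 1 + n"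
    using a by (intro poly_mapping_eqI)
      (auto simp: n_def lookup_add lookup_minus lookup_single when_def)
  have "(\<Sum>i\<in>UNIV. Poly_Mapping.lookup m i) = 1 + (\<Sum>i\<in>UNIV. Poly_Mapping.lookup n i)"
    by (simp add: m lookup_add sum.distrib lookup_single when_def)
  with assms m that show ?thesis by simp
qed

lemma degree_two_monomial:
  fixes m :: "4 \<Rightarrow>\<^sub>0 nat"
  assumes "(\<Sum>i\<in>UNIV. Poly_Mapping.lookup m i) = 2"
  obtains a b where "m = mon2 a b"
proof -
  obtain a n where m: "m = Poly_Mapping.single a 1 + n"
    and n: "(\<Sum>i\<in>UNIV. Poly_Mapping.lookup n i) = Suc 0"
    using degree_Suc_monomial[of m "Suc 0"] assms by (auto simp: numeral_2_eq_2)
  obtain b k where nk: "n = Poly_Mapping.single b 1 + k"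
    and k: "(\<Sum>i\<in>UNIV. Poly_Mapping.lookup k i) = 0"
    using degree_Suc_monomial[OF n] by blast
  have "k = 0"
    using k by (intro poly_mapping_eqI) simp
  with m nk that show ?thesis by simp
qed

text \<open>The symmetric coefficients are found monomial by monomial: the quadratic polynomials that have
  them are closed under addition, and every polynomial is the sum of its terms.\<close>

lemma quadric_coefficients:
  assumes "homogeneous 2 f"
  obtains c where "\<And>i j. c i j = c j i"
    and "f = (\<Sum>i\<in>UNIV. \<Sum>j\<in>UNIV. Poly_Mapping.single (mon2 i j) (c i j))"
proof -
  define P where "P f \<longleftrightarrow> (\<exists>c. (\<forall>i j. c i j = c j i) \<and>
    f = (\<Sum>i\<in>UNIV. \<Sum>j\<in>UNIV. Poly_Mapping.single (mon2 i j) (c i j)))" for f :: cpoly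
  have P_zero: "P 0"
    unfolding P_def by (rule exI[of _ "\<lambda>_ _. 0"]) simp
  have P_add: "P (f + g)" if f: "P f" and g: "P g" for f g
  proof -
    from f g obtain c d
      where "\<forall>i j. c i j = c j i" "f = (\<Sum>i\<in>UNIV. \<Sum>j\<in>UNIV. Poly_Mapping.single (mon2 i j) (c i j))"
        and "\<forall>i j. d i j = d j i" "g = (\<Sum>i\<in>UNIV. \<Sum>j\<in>UNIV. Poly_Mapping.single (mon2 i j) (d i j))"
      unfolding P_def by blast
    then show ?thesis
      unfolding P_def
      by (intro exI[of _ "\<lambda>i j. c i j + d i j"]) (simp add: single_add sum.distrib)
  qed
  have P_single: "P (Poly_Mapping.single (mon2 a b) k)" for a b k
  proof -
    \<comment> \<open>The off-diagonal coefficient is shared equally between the two orders of its indices.\<close>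
    let ?c = "\<lambda>i j. (if i = a \<and> j = b then k / 2 else 0) + (if i = b \<and> j = a then k / 2 else 0)"
    have one: "(\<Sum>i\<in>UNIV. \<Sum>j\<in>UNIV. Poly_Mapping.single (mon2 i j) (if i = a \<and> j = b then k / 2 else 0)) =
        Poly_Mapping.single (mon2 a b) (k / 2)" for a b :: 4
    proof -
      have "(\<Sum>j\<in>UNIV. Poly_Mapping.single (mon2 i j) (if i = a \<and> j = b then k / 2 else 0)) =
          (if i = a then Poly_Mapping.single (mon2 a b) (k / 2) else 0)" for i
      proof -
        have "(\<Sum>j\<in>UNIV. Poly_Mapping.single (mon2 i j) (if i = a \<and> j = b then k / 2 else 0)) =
          (\<Sum>j\<in>UNIV. if j = b then (if i = a then Poly_Mapping.single (mon2 a b) (k / 2) else 0) else 0)"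
          by (rule sum.cong) auto
        then show ?thesis by simp
      qed
      then show ?thesis by simp
    qed
    have "(\<Sum>i\<in>UNIV. \<Sum>j\<in>UNIV. Poly_Mapping.single (mon2 i j) (?c i j)) =
        Poly_Mapping.single (mon2 a b) (k / 2) + Poly_Mapping.single (mon2 b a) (k / 2)"
      unfolding single_add sum.distrib one ..
    also have "mon2 b a = mon2 a b"
      by (rule add.commute)
    also have "Poly_Mapping.single (mon2 a b) (k / 2) + Poly_Mapping.single (mon2 a b) (k / 2) =
        Poly_Mapping.single (mon2 a b) k"
      unfolding single_add[symmetric] by simp
    finally have eq: "Poly_Mapping.single (mon2 a b) k =
        (\<Sum>i\<in>UNIV. \<Sum>j\<in>UNIV. Poly_Mapping.single (mon2 i j) (?c i j))" ..
    have sym: "\<forall>i j. ?c i j = ?c j i"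
      by (simp only: add.commute conj_commute simp_thms)
    show ?thesis
      unfolding P_def by (rule exI[where x = ?c], rule conjI[OF sym eq])
  qed
  have "P (\<Sum>m\<in>M. Poly_Mapping.single m (Poly_Mapping.lookup f m))"
    if "M \<subseteq> Poly_Mapping.keys f" for M
    using finite_subset[OF that finite_keys] that
  proof (induction M rule: finite_induct)
    case empty
    then show ?case by (simp add: P_zero)
  next
    case (insert m M)
    then have "(\<Sum>i\<in>UNIV. Poly_Mapping.lookup m i) = 2"
      using assms by (simp add: homogeneous_def)
    then obtain a b where "m = mon2 a b" by (rule degree_two_monomial)
    then have "P (Poly_Mapping.single m (Poly_Mapping.lookup f m))"
      using P_single by metis
    with insert show ?case by (simp add: P_add)
  qed
  then have "P f"
    using cpoly_eq_sum_single[of f] by (metis order_refl)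
  then show ?thesis using that unfolding P_def by blast
qed

definition bilin :: "(4 \<Rightarrow> 4 \<Rightarrow> complex) \<Rightarrow> complex ^ 4 \<Rightarrow> complex ^ 4 \<Rightarrow> complex" where
  "bilin c x y = (\<Sum>i\<in>UNIV. \<Sum>j\<in>UNIV. c i j * x $ i * y $ j)"

lemma bilin_simps [simp]:
  "bilin c (x + y) z = bilin c x z + bilin c y z" "bilin c z (x + y) = bilin c z x + bilin c z y"
  "bilin c (x - y) z = bilin c x z - bilin c y z" "bilin c z (x - y) = bilin c z x - bilin c z y"
  "bilin c (k *s x) z = k * bilin c x z" "bilin c z (k *s x) = k * bilin c z x"
  "bilin c (0::complex^4) z = 0" "bilin c z (0::complex^4) = 0"
  by (simp_all add: bilin_def algebra_simps sum.distrib sum_distrib_left sum_subtractf)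

lemma bilin_commute: "(\<And>i j. c i j = c j i) \<Longrightarrow> bilin c x y = bilin c y x"
  unfolding bilin_def by (subst sum.swap) (auto intro!: sum.cong)

lemma peval_quadric:
  "peval (\<Sum>i\<in>UNIV. \<Sum>j\<in>UNIV. Poly_Mapping.single (mon2 i j) (c i j)) x = bilin c x x"
proof -
  have "(\<Prod>l\<in>UNIV. x $ l ^ Poly_Mapping.lookup (mon2 i j) l) = x $ i * x $ j" for i j
  proof -
    have "(\<Prod>l\<in>UNIV. x $ l ^ Poly_Mapping.lookup (mon2 i j) l) =
        (\<Prod>l\<in>UNIV. (if l = i then x $ l else 1) * (if l = j then x $ l else 1))"
      by (rule prod.cong) (auto simp: lookup_add lookup_single when_def)
    then show ?thesis by (simp add: prod.distrib)
  qed
  then show ?thesis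
    by (simp add: peval_sum peval_single bilin_def mult.assoc)
qed

lemma bilin_axis: "bilin c (axis i 1) (axis j 1) = c i j"
proof -
  have "(\<Sum>l\<in>UNIV. c k l * axis i 1 $ k * axis j 1 $ l) = (if k = i then c i j else 0)" for k
  proof -
    have "(\<Sum>l\<in>UNIV. c k l * axis i 1 $ k * axis j 1 $ l) =
        (\<Sum>l\<in>UNIV. if l = j then (if k = i then c i j else 0) else 0)"
      by (rule sum.cong) (auto simp: axis_def)
    then show ?thesis by simp
  qed
  then show ?thesis by (simp add: bilin_def)
qed

text \<open>The last conclusion turns vanishing of the quadratic form as a function into vanishing as a
  polynomial: if all \<open>B(x, x)\<close> are zero, then so are all \<open>B\<close> at pairs of unit vectors, and
  these are the coefficients.\<close>

lemma quadric_polarization: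
  assumes "homogeneous 2 f"
  obtains c where "\<And>x y. bilin c x y = bilin c y x" "\<And>x. peval f x = bilin c x x"
    and "(\<And>x. bilin c x x = 0) \<Longrightarrow> f = 0"
proof -
  obtain c where sym: "\<And>i j. c i j = c j i"
    and f: "f = (\<Sum>i\<in>UNIV. \<Sum>j\<in>UNIV. Poly_Mapping.single (mon2 i j) (c i j))"
    using quadric_coefficients[OF assms] by blast
  have "f = 0" if zero: "\<And>x. bilin c x x = 0"
  proof -
    have "c i j = 0" for i j
      using zero[of "axis i 1 + axis j 1"] zero[of "axis i 1"] zero[of "axis j 1"] sym[of j i]
      by (simp add: bilin_axis)
    then show ?thesis by (simp add: f)
  qed
  then show ?thesis
  proof (rule that[rotated 2])
    show "bilin c x y = bilin c y x" for x y by (rule bilin_commute) (rule sym)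
    show "peval f x = bilin c x x" for x unfolding f by (rule peval_quadric)
  qed
qed

text \<open>The dimension of a vector space that is not finitely generated is \<open>0\<close> by convention, so the
  step from a nonzero cone to positive dimension needs the finitely many quadratic monomials as
  a spanning set.\<close>

lemma cone_dim_pos_iff:
  "cone_dim Z P > 0 \<longleftrightarrow> (\<exists>f \<in> vanishing_ideal Z \<inter>
     ideal_mult (vanishing_ideal {P}) (vanishing_ideal {P}). homogeneous 2 f \<and> f \<noteq> 0)"
proof -
  define V where "V = graded_part 2
     (vanishing_ideal Z \<inter> ideal_mult (vanishing_ideal {P}) (vanishing_ideal {P}))"
  define M where "M = (\<lambda>(i, j). Poly_Mapping.single (mon2 i j) (1::complex)) ` UNIV"
  have M: "finite M" unfolding M_def by simp
  have "V \<subseteq> cpoly.span M"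
  proof
    fix f assume "f \<in> V"
    then have "homogeneous 2 f" by (simp add: V_def graded_part_def)
    then obtain c where
      f: "f = (\<Sum>i\<in>UNIV. \<Sum>j\<in>UNIV. Poly_Mapping.single (mon2 i j) (c i j))"
      using quadric_coefficients by blast
    have "Poly_Mapping.single (mon2 i j) (c i j) \<in> cpoly.span M" for i j
    proof -
      have "Poly_Mapping.single (mon2 i j) (c i j) = cscale (c i j) (Poly_Mapping.single (mon2 i j) 1)"
        by (simp add: cscale_def mult_single)
      moreover have "Poly_Mapping.single (mon2 i j) 1 \<in> M"
        unfolding M_def by (auto intro: image_eqI[of _ _ "(i, j)"])
      ultimately show ?thesis by (simp add: cpoly.span_base cpoly.span_scale)
    qed
    then show "f \<in> cpoly.span M" unfolding f by (intro cpoly.span_sum)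
  qed
  obtain B where B: "B \<subseteq> V" "cpoly.independent B" "V \<subseteq> cpoly.span B" "card B = cpoly.dim V"
    using cpoly.basis_exists by blast
  have "finite B"
    using cpoly.independent_span_bound[OF M B(2)] B(1) \<open>V \<subseteq> cpoly.span M\<close> by blast
  have "cpoly.dim V > 0 \<longleftrightarrow> (\<exists>f\<in>V. f \<noteq> 0)"
  proof
    assume "cpoly.dim V > 0"
    then have "B \<noteq> {}" using B(4) by force
    then obtain f where "f \<in> B" by blast
    moreover from this have "f \<noteq> 0" using B(2) cpoly.dependent_zero[of B] by metis
    ultimately show "\<exists>f\<in>V. f \<noteq> 0" using B(1) by (meson subsetD)
  next
    assume "\<exists>f\<in>V. f \<noteq> 0"
    then have "B \<noteq> {}" using B(3) by auto
    then show "cpoly.dim V > 0" using B(4) \<open>finite B\<close> card_gt_0_iff by metis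
  qed
  then show ?thesis
    unfolding cone_dim_def V_def[symmetric] by (auto simp: V_def graded_part_def)
qed

text \<open>Each factor of a product in \<open>I(P)\<^sup>2\<close> vanishes at \<open>t = 0\<close> along the line \<open>p + t v\<close>, so \<open>f\<close>
  restricted to that line is divisible by \<open>t\<^sup>2\<close>; its linear coefficient is \<open>2 B(p, v)\<close>.\<close>

lemma singular_at_vertex:
  assumes f: "f \<in> ideal_mult (vanishing_ideal {P}) (vanishing_ideal {P})"
    and p: "p \<in> ray P" and c: "\<And>x. peval f x = bilin c x x" "\<And>x y. bilin c x y = bilin c y x"
  shows "bilin c p v = 0"
proof -
  obtain n :: nat and g h where fgh: "f = (\<Sum>i<n. g i * h i)"
    and van: "\<And>i. i < n \<Longrightarrow> peval (g i) p = 0" "\<And>i. i < n \<Longrightarrow> peval (h i) p = 0"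
    using f p unfolding ideal_mult_def vanishing_ideal_def by blast
  have "\<exists>q. \<forall>t. peval k (p + t *s v) = poly q t" for k
    by (rule peval_along_line[of k p v]) blast
  then obtain r where r: "\<And>k t. peval k (p + t *s v) = poly (r k) t" by metis
  have root: "[:0, 1:] dvd r k" if "peval k p = 0" for k
    using that r[of k 0] by (simp add: dvd_iff_poly_eq_0)
  define s where "s = (\<Sum>i<n. r (g i) * r (h i))"
  have s: "[:0, 1:]\<^sup>2 dvd s"
    unfolding s_def power2_eq_square by (intro dvd_sum mult_dvd_mono root van) simp_all
  have "poly s t = poly [:bilin c p p, 2 * bilin c p v, bilin c v v:] t" for t
  proof -
    have "poly s t = peval f (p + t *s v)"
      by (simp add: s_def fgh peval_sum peval_mult poly_sum flip: r)
    then show ?thesis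
      by (simp add: c(1) c(2)[of v p] algebra_simps)
  qed
  then have "s = [:bilin c p p, 2 * bilin c p v, bilin c v v:]"
    by (simp add: poly_eq_poly_eq_iff[symmetric] fun_eq_iff)
  moreover obtain k where "s = [:0, 0, 1:] * k"
    using s by (auto simp: power2_eq_square elim: dvdE)
  ultimately have "coeff ([:0, 0, 1:] * k) 1 = 2 * bilin c p v" by simp
  then show ?thesis by simp
qed

lemma ideal_mult_list:
  assumes "set us \<subseteq> I \<times> J"
  shows "(\<Sum>(f, g)\<leftarrow>us. f * g) \<in> ideal_mult I J"
proof -
  have "(\<Sum>(f, g)\<leftarrow>us. f * g) = (\<Sum>i<length us. fst (us ! i) * snd (us ! i))"
    by (simp add: sum_list_sum_nth case_prod_unfold atLeast0LessThan)
  moreover have "us ! i \<in> I \<times> J" if "i < length us" for i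
    using assms that nth_mem by blast
  then have "\<forall>i<length us. fst (us ! i) \<in> I \<and> snd (us ! i) \<in> J"
    by (simp add: mem_Times_iff)
  ultimately show ?thesis unfolding ideal_mult_def
    by (intro CollectI exI[of _ "length us"] exI[of _ "\<lambda>i. fst (us ! i)"] exI[of _ "\<lambda>i. snd (us ! i)"]) simp
qed

section \<open>Projective points and harmonic conjugates\<close>

lemma distinct_4 [simp]:
  "(1::4) \<noteq> 2" "(1::4) \<noteq> 3" "(1::4) \<noteq> 4" "(2::4) \<noteq> 1" "(2::4) \<noteq> 3" "(2::4) \<noteq> 4"
  "(3::4) \<noteq> 1" "(3::4) \<noteq> 2" "(3::4) \<noteq> 4" "(4::4) \<noteq> 1" "(4::4) \<noteq> 2" "(4::4) \<noteq> 3"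
  by simp_all

lemma nonzero_of_dual: "dual c x \<noteq> 0 \<Longrightarrow> x \<noteq> 0"
  by auto

lemma span_scaled: "k \<noteq> 0 \<Longrightarrow> vec.span {k *s x} = vec.span {x :: complex ^ 4}"
proof -
  assume "k \<noteq> 0"
  then have "x = inverse k *s (k *s x)" by simp
  then have "x \<in> vec.span {k *s x}"
    by (metis vec.span_base vec.span_scale singletonI)
  moreover have "k *s x \<in> vec.span {x}" by (simp add: vec.span_base vec.span_scale)
  ultimately show ?thesis by (simp add: vec.span_eq)
qed

lemma ray_generator:
  obtains x where "x \<noteq> 0" "ray p = vec.span {x}"
proof -
  have "vec.subspace (ray p)" "vec.dim (ray p) = 1"
    using ray[of p] by auto
  then obtain B where B: "B \<subseteq> ray p" "vec.independent B" "ray p \<subseteq> vec.span B" "card B = 1"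
    using vec.basis_exists by metis
  from B(4) obtain x where x: "B = {x}" by (auto simp: card_1_singleton_iff)
  have "ray p = vec.span {x}"
    using B x \<open>vec.subspace (ray p)\<close> vec.span_minimal by blast
  moreover have "x \<noteq> 0" using B(2) x by (simp add: vec.dependent_single)
  ultimately show ?thesis using that by blast
qed

lemma point_through:
  fixes x :: "complex ^ 4"
  assumes "x \<noteq> 0"
  obtains p where "ray p = vec.span {x}"
proof -
  have "vec.independent {x}" using assms by (simp add: vec.dependent_single)
  then have "vec.dim (vec.span {x}) = 1"
    by (simp add: vec.dim_eq_card_independent)
  then have "ray (Abs_proj3 (vec.span {x})) = vec.span {x}"
    by (intro Abs_proj3_inverse) simp
  then show ?thesis using that by blast
qed

lemma mem_span_singleton: "y \<in> vec.span {x :: complex ^ 4} \<longleftrightarrow> (\<exists>k. y = k *s x)"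
  by (auto simp: vec.span_singleton)

text \<open>On an affine line with \<open>O\<close> at infinity the harmonic conjugate is the midpoint of \<open>P\<close> and \<open>Q\<close>;
  here \<open>e\<close> is half of the difference vector. In coordinates, the relation between three vectors
  of a plane gives representatives \<open>p, q\<close> of \<open>P, Q\<close> with \<open>p - q\<close> on \<open>O\<close>, and the cross-ratio
  \<open>-1\<close> says that \<open>p + q\<close> lies on \<open>H\<close>.\<close>

lemma harmonic_representatives:
  assumes harm: "harmonic_conjugate H pO P Q" and "P \<noteq> Q"
    and e: "ray pO = vec.span {e}" "e \<noteq> 0"
  obtains h where "ray H = vec.span {h}" "ray P = vec.span {h + e}" "ray Q = vec.span {h - e}"
proof -
  obtain u v a h c d where
    coords: "line_coords u v pO a" "line_coords u v H h" "line_coords u v P c" "line_coords u v Q d"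
    and nz: "bracket h c \<noteq> 0" "bracket a d \<noteq> 0"
    and cr: "-1 = (bracket a c * bracket h d) / (bracket h c * bracket a d)"
    using harm unfolding harmonic_conjugate_def has_cross_ratio_def by blast
  define V where "V x = x $ 1 *s u + x $ 2 *s v" for x :: "complex ^ 2"
  have rays: "ray pO = vec.span {V a}" "ray H = vec.span {V h}"
    "ray P = vec.span {V c}" "ray Q = vec.span {V d}"
    using coords by (simp_all add: line_coords_def V_def)
  have cr': "bracket a c * bracket h d = - bracket h c * bracket a d"
    using cr nz by (simp add: field_simps)
  then have nz': "bracket a c \<noteq> 0" "bracket h d \<noteq> 0"
    using nz by auto
  \<comment> \<open>Cramer's rule for expressing \<open>x\<close> through \<open>c\<close> and \<open>d\<close> in dimension two.\<close>
  have relation: "bracket x d *s V c - bracket x c *s V d = bracket c d *s V x" for x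
    by (simp add: V_def bracket_def vec_eq_iff algebra_simps)
  have "bracket c d \<noteq> 0"
  proof
    assume "bracket c d = 0"
    then have "bracket a d *s V c = bracket a c *s V d"
      using relation[of a] by simp
    then have "vec.span {V c} = vec.span {V d}"
      using span_scaled nz(2) nz'(1) by metis
    then have "ray P = ray Q" using rays by simp
    then show False
      using \<open>P \<noteq> Q\<close> by (simp add: ray_inject)
  qed
  obtain k where k: "e = k *s V a"
    using e rays(1) mem_span_singleton vec.span_base by (metis singletonI)
  then have "k \<noteq> 0" using e by auto
  define h' where "h' = (k / bracket c d) *s (bracket a d *s V c + bracket a c *s V d)"
  have Va: "V a = (1 / bracket c d) *s (bracket a d *s V c - bracket a c *s V d)"
    using \<open>bracket c d \<noteq> 0\<close> by (simp add: relation)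
  have e': "e = (k / bracket c d) *s (bracket a d *s V c - bracket a c *s V d)"
    unfolding k Va by simp
  have P: "h' + e = (2 * k * bracket a d / bracket c d) *s V c"
    by (simp add: h'_def e' vec_eq_iff algebra_simps)
  have Q: "h' - e = (2 * k * bracket a c / bracket c d) *s V d"
    by (simp add: h'_def e' vec_eq_iff algebra_simps)
  \<comment> \<open>The cross-ratio enters here: it makes the sum of the two representatives proportional to \<open>V h\<close>.\<close>
  have "(bracket h d) *s (bracket a d *s V c + bracket a c *s V d) =
      bracket a d *s (bracket h d *s V c - bracket h c *s V d)"
    using cr' by (simp add: vec_eq_iff algebra_simps)
  also have "\<dots> = (bracket a d * bracket c d) *s V h"
    by (simp add: relation)
  finally have "bracket a d *s V c + bracket a c *s V d =
      (bracket a d * bracket c d / bracket h d) *s V h"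
    using nz'(2) by (simp add: vec_eq_iff field_simps)
  then have H: "h' = (k * bracket a d / bracket h d) *s V h"
    using \<open>bracket c d \<noteq> 0\<close> by (simp add: h'_def)
  show ?thesis
  proof
    show "ray H = vec.span {h'}" "ray P = vec.span {h' + e}" "ray Q = vec.span {h' - e}"
      unfolding P Q unfolding H rays
      using nz nz' \<open>k \<noteq> 0\<close> \<open>bracket c d \<noteq> 0\<close> by (simp_all add: span_scaled)
  qed
qed

lemma dim_UNIV_4: "vec.dim (UNIV :: (complex ^ 4) set) = 4"
  by (simp add: vec_dim_card del: vec.dim_UNIV)

lemma line_eq_span:
  assumes "is_line L" "p \<in> L" "q \<in> L" "p \<noteq> q"
    and "ray p = vec.span {x}" "ray q = vec.span {y}"
  shows "L = {r. ray r \<subseteq> vec.span {x, y}}"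
proof -
  obtain W where W: "vec.subspace W" "vec.dim W = 2" "L = {r. ray r \<subseteq> W}"
    using assms(1) by (auto simp: proj_subspace_def)
  have xy: "x \<in> W" "y \<in> W"
    using assms(2,3,5,6) W(3) vec.span_superset[of "{x}"] vec.span_superset[of "{y}"] by auto
  have "\<not> vec.span {y} \<subseteq> vec.span {x}"
  proof
    assume le: "vec.span {y} \<subseteq> vec.span {x}"
    have "vec.dim (ray p) = 1" "vec.dim (ray q) = 1" using ray by auto
    then have "vec.span {y} = vec.span {x}"
      using le assms(5,6) by (metis order_refl vec.subspace_dim_equal vec.subspace_span)
    then show False using assms(4-6) by (metis ray_inject)
  qed
  then have "y \<notin> vec.span {x}"
    by (metis empty_subsetI insert_subset vec.span_minimal vec.subspace_span)
  moreover have "vec.dim {x} = 1"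
    using ray[of p] assms(5) by auto
  ultimately have "vec.dim (vec.span {x, y}) = 2"
    using vec.dim_insert[of y "{x}"] by (simp add: insert_commute)
  moreover have "vec.span {x, y} \<subseteq> W"
    using xy W(1) by (simp add: vec.span_minimal)
  ultimately have "vec.span {x, y} = W"
    using W(1,2) vec.subspace_dim_equal[of "vec.span {x, y}" W] by simp
  then show ?thesis using W(3) by simp
qed

text \<open>This is for deriving independence of the lines from noncoplanarity: the latter excludes planes
  only, whereas a span that fails to be the whole space may also be smaller than a plane.\<close>

lemma subspace_of_dim_3:
  fixes S :: "(complex ^ 4) set"
  assumes "vec.subspace S" "vec.dim S \<le> 3"
  obtains W where "vec.subspace W" "vec.dim W = 3" "S \<subseteq> W"
proof -
  have "\<exists>W. vec.subspace W \<and> vec.dim W = 3 \<and> S \<subseteq> W"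
    using assms
  proof (induction "3 - vec.dim S" arbitrary: S)
    case 0
    then show ?case by auto
  next
    case (Suc n)
    have "S \<noteq> UNIV"
    proof
      assume "S = UNIV"
      then have "vec.dim S = 4" by (simp add: dim_UNIV_4 del: vec.dim_UNIV)
      with Suc.prems show False by simp
    qed
    then obtain x where x: "x \<notin> S" by blast
    let ?T = "vec.span (insert x S)"
    have "vec.dim ?T = vec.dim S + 1"
      using x Suc.prems(1) by (simp add: vec.dim_insert vec.span_eq_iff[THEN iffD2])
    then have "n = 3 - vec.dim ?T" "vec.dim ?T \<le> 3"
      using Suc.hyps(2) by linarith+
    then obtain W where "vec.subspace W" "vec.dim W = 3" "?T \<subseteq> W"
      using Suc.hyps(1)[OF _ vec.subspace_span] by blast
    then show ?case
      by (meson dual_order.trans subset_insertI vec.span_superset)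
  qed
  then show ?thesis using that by blast
qed

section \<open>Coordinate planes of a basis\<close>

text \<open>A basis \<open>b\<close> together with its coordinate functionals, each \<open>\<phi> j\<close> being the coefficient vector
  of the linear form that reads off the coordinate along \<open>b j\<close>. The functionals are carried
  along because the cones are built from them as polynomials.\<close>

locale frame =
  fixes b \<phi> :: "4 \<Rightarrow> complex ^ 4"
  assumes dual_basis: "dual (\<phi> i) (b j) = (if i = j then 1 else 0)"
    and expansion: "x = (\<Sum>j\<in>UNIV. dual (\<phi> j) x *s b j)"
begin

lemma coordinate_hyperplane:
  "vec.span (b ` {j. j \<noteq> k}) = {x. dual (\<phi> k) x = 0}"
proof
  have "vec.subspace {x. dual (\<phi> k) x = 0}"
    by (simp add: vec.subspace_def)
  then show "vec.span (b ` {j. j \<noteq> k}) \<subseteq> {x. dual (\<phi> k) x = 0}"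
    by (intro vec.span_minimal) (auto simp: dual_basis)
  show "{x. dual (\<phi> k) x = 0} \<subseteq> vec.span (b ` {j. j \<noteq> k})"
  proof
    fix x assume x: "x \<in> {x. dual (\<phi> k) x = 0}"
    have "dual (\<phi> j) x *s b j \<in> vec.span (b ` {j. j \<noteq> k})" for j
    proof (cases "j = k")
      case True
      then show ?thesis using x by (simp add: vec.span_zero)
    qed (simp add: vec.span_base vec.span_scale)
    then have "(\<Sum>j\<in>UNIV. dual (\<phi> j) x *s b j) \<in> vec.span (b ` {j. j \<noteq> k})"
      by (intro vec.span_sum)
    then show "x \<in> vec.span (b ` {j. j \<noteq> k})" using expansion[of x] by simp
  qed
qed

lemma span_basis: "vec.span (range b) = UNIV"
proof -
  have "dual (\<phi> j) x *s b j \<in> vec.span (range b)" for j x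
    by (simp add: vec.span_base vec.span_scale)
  then have "(\<Sum>j\<in>UNIV. dual (\<phi> j) x *s b j) \<in> vec.span (range b)" for x
    by (intro vec.span_sum)
  then have "x \<in> vec.span (range b)" for x by (subst expansion)
  then show ?thesis by blast
qed

lemma dim_coordinate_hyperplane: "vec.dim (vec.span (b ` {j. j \<noteq> k})) = 3"
proof -
  let ?S = "b ` {j. j \<noteq> k}"
  have "range b = insert (b k) ?S" by auto
  moreover have "vec.dim (range b) = 4"
    using vec.dim_span[of "range b"] by (simp add: span_basis dim_UNIV_4 del: vec.dim_UNIV vec.dim_span)
  moreover have "b k \<notin> vec.span ?S"
    by (simp add: coordinate_hyperplane dual_basis)
  ultimately show ?thesis by (simp add: vec.dim_insert)
qed

definition face :: "4 \<Rightarrow> proj3 set" where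
  "face k = {p. \<forall>x\<in>ray p. dual (\<phi> k) x = 0}"

lemma mem_face: "ray p = vec.span {x} \<Longrightarrow> p \<in> face k \<longleftrightarrow> dual (\<phi> k) x = 0"
  using vec.span_base[of x "{x}"] by (auto simp: face_def mem_span_singleton)

lemma lin_span_eq_face:
  assumes "vec.span (\<Union>q\<in>S. ray q) = vec.span (b ` {j. j \<noteq> k})"
  shows "is_plane (lin_span S)" "lin_span S = face k"
proof -
  have S: "lin_span S = {p. ray p \<subseteq> vec.span (b ` {j. j \<noteq> k})}"
    unfolding lin_span_def assms ..
  then show "is_plane (lin_span S)"
    unfolding proj_subspace_def
    by (intro exI[of _ "vec.span (b ` {j. j \<noteq> k})"]) (simp add: dim_coordinate_hyperplane del: vec.dim_span)
  show "lin_span S = face k"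
    unfolding S face_def coordinate_hyperplane by auto
qed

end

lemma frame_of_spanning:
  assumes "vec.span (range b) = UNIV"
  obtains \<phi> where "frame b \<phi>"
proof -
  define A :: "complex ^ 4 ^ 4" where "A = (\<chi> i j. b j $ i)"
  have col: "column j A = b j" for j
    by (simp add: A_def column_def vec_eq_iff)
  have "columns A = range b" by (auto simp: columns_def col)
  then obtain B where AB: "A ** B = mat 1"
    using assms matrix_right_invertible_span_columns by metis
  then have BA: "B ** A = mat 1" using matrix_left_right_inverse by blast
  have coord: "dual (B $ j) x = (B *v x) $ j" for j x
    by (simp add: dual_def matrix_vector_mult_def)
  have "frame b (\<lambda>j. B $ j)"
  proof
    show "dual (B $ i) (b j) = (if i = j then 1 else 0)" for i j
    proof -
      have "dual (B $ i) (b j) = (B ** A) $ i $ j"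
        by (simp add: dual_def A_def matrix_matrix_mult_def)
      then show ?thesis by (simp add: BA mat_def)
    qed
    show "x = (\<Sum>j\<in>UNIV. dual (B $ j) x *s b j)" for x
    proof -
      have "(\<Sum>j\<in>UNIV. dual (B $ j) x *s b j) = A *v (B *v x)"
        by (simp add: matrix_mult_sum coord col)
      then show ?thesis by (simp add: matrix_vector_mul_assoc AB)
    qed
  qed
  then show ?thesis using that by blast
qed

section \<open>Cones through the symmetric six points\<close>

text \<open>The six points in coordinates adapted to them: \<open>b 4\<close> spans \<open>O\<close>, the other three basis vectors
  span the harmonic conjugates, and the sign \<open>s\<close> distinguishes \<open>P\<^sub>i\<close> from \<open>Q\<^sub>i\<close>.\<close>

locale symmetric_six = frame +
  fixes Z :: "proj3 set"
  assumes mem_Z: "p \<in> Z \<longleftrightarrow>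
    (\<exists>i s. i \<noteq> 4 \<and> s\<^sup>2 = 1 \<and> ray p = vec.span {b i + s *s b 4})"
begin

lemma mem_Z_cases:
  assumes "p \<in> Z"
  obtains i s where "i \<noteq> 4" "s\<^sup>2 = 1" "ray p = vec.span {b i + s *s b 4}"
  using assms mem_Z by auto

lemma rep_mem_Z:
  assumes "i \<noteq> 4" "s\<^sup>2 = 1"
  obtains p where "p \<in> Z" "b i + s *s b 4 \<in> ray p"
proof -
  have "b i + s *s b 4 \<noteq> 0"
    by (rule nonzero_of_dual[of "\<phi> i"]) (use assms(1) in \<open>simp add: dual_basis\<close>)
  then obtain p where p: "ray p = vec.span {b i + s *s b 4}"
    using point_through by blast
  show ?thesis
  proof
    show "p \<in> Z" using assms p mem_Z by blast
    show "b i + s *s b 4 \<in> ray p" unfolding p by (rule vec.span_base) simp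
  qed
qed

text \<open>The two points on each line force \<open>B(b i, b 4) = 0\<close> and \<open>B(b i, b i) = - B(b 4, b 4)\<close>.
  Singularity at \<open>p\<close> in the direction \<open>b 4\<close> then kills all diagonal entries, and the remaining
  three equations in the three mixed entries have determinant \<open>2 x\<^sub>1 x\<^sub>2 x\<^sub>3\<close> up to sign.\<close>

lemma cone_dim_off_faces:
  assumes P: "ray P = vec.span {p}" and p: "\<And>j. dual (\<phi> j) p \<noteq> 0"
  shows "cone_dim Z P = 0"
proof (rule ccontr)
  assume "cone_dim Z P \<noteq> 0"
  then obtain f where f: "f \<in> vanishing_ideal Z"
    "f \<in> ideal_mult (vanishing_ideal {P}) (vanishing_ideal {P})" "homogeneous 2 f" "f \<noteq> 0"
    using cone_dim_pos_iff[of Z P] by auto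
  obtain c where sym: "\<And>x y. bilin c x y = bilin c y x" and c: "\<And>x. peval f x = bilin c x x"
    and nonzero: "(\<And>x. bilin c x x = 0) \<Longrightarrow> f = 0"
    using quadric_polarization[OF f(3)] by blast
  define B where "B i j = bilin c (b i) (b j)" for i j
  have B_sym: "B i j = B j i" for i j unfolding B_def by (rule sym)
  have on_Z: "B i i + B 4 4 + 2 * s * B i 4 = 0" if i: "i \<noteq> 4" and s: "s\<^sup>2 = 1" for i s
  proof -
    obtain z where "z \<in> Z" "b i + s *s b 4 \<in> ray z" by (rule rep_mem_Z[OF i s])
    then have "peval f (b i + s *s b 4) = 0" using f(1) by (auto simp: vanishing_ideal_def)
    moreover have "peval f (b i + s *s b 4) = B i i + s\<^sup>2 * B 4 4 + 2 * s * B i 4"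
      using sym[of "b 4" "b i"] by (simp add: c B_def algebra_simps power2_eq_square)
    ultimately show ?thesis by (simp add: s)
  qed
  have edge: "B i 4 = 0" and diag: "B i i = - B 4 4" if "i \<noteq> 4" for i
  proof -
    show "B i 4 = 0" using on_Z[OF that, of 1] on_Z[OF that, of "-1"] by simp
    then show "B i i = - B 4 4" using on_Z[OF that, of 1] by (simp add: eq_neg_iff_add_eq_0)
  qed
  have "p \<in> ray P" using P by (simp add: vec.span_base)
  then have "bilin c p (b k) = 0" for k
    using singular_at_vertex[OF f(2)] c sym by blast
  moreover have "bilin c p (b k) = (\<Sum>j\<in>UNIV. dual (\<phi> j) p * B j k)" for k
  proof -
    have "bilin c (\<Sum>j\<in>UNIV. dual (\<phi> j) p *s b j) (b k) = (\<Sum>j\<in>UNIV. dual (\<phi> j) p * B j k)"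
      by (simp add: sum_4 B_def)
    then show ?thesis using expansion[of p] by simp
  qed
  ultimately have sing: "dual (\<phi> 1) p * B 1 k + dual (\<phi> 2) p * B 2 k +
      dual (\<phi> 3) p * B 3 k + dual (\<phi> 4) p * B 4 k = 0" for k
    by (simp add: sum_4)
  have B44: "B 4 4 = 0"
    using sing[of 4] p[of 4] by (simp add: edge)
  have Bii: "B i i = 0" for i using diag[of i] B44 by (cases "i = 4") auto
  have B4: "B 4 i = 0" for i using edge[of i] B44 B_sym[of 4 i] by (cases "i = 4") auto
  have 1: "dual (\<phi> 2) p * B 1 2 = - dual (\<phi> 3) p * B 1 3"
    using sing[of 1] by (simp add: Bii B4 B_sym[of 2 1] B_sym[of 3 1] eq_neg_iff_add_eq_0)
  have 2: "dual (\<phi> 1) p * B 1 2 = - dual (\<phi> 3) p * B 2 3"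
    using sing[of 2] by (simp add: Bii B4 B_sym[of 3 2] eq_neg_iff_add_eq_0)
  have 3: "dual (\<phi> 1) p * B 1 3 = - dual (\<phi> 2) p * B 2 3"
    using sing[of 3] by (simp add: Bii B4 eq_neg_iff_add_eq_0)
  have "2 * dual (\<phi> 1) p * dual (\<phi> 2) p * B 1 2 = 0" using 1 2 3 by algebra
  then have B12: "B 1 2 = 0" using p by simp
  then have B13: "B 1 3 = 0" and B23: "B 2 3 = 0" using 1 2 p by auto
  have "B i j = 0" for i j
    using exhaust_4[of i] exhaust_4[of j] B12 B13 B23 Bii B4 B_sym by metis
  then have zero: "bilin c (b i) (b j) = 0" for i j by (simp add: B_def)
  have "bilin c x x = 0" for x
  proof -
    have "bilin c (\<Sum>j\<in>UNIV. dual (\<phi> j) x *s b j) (\<Sum>j\<in>UNIV. dual (\<phi> j) x *s b j) = 0"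
      by (simp add: sum_4 zero)
    then show ?thesis using expansion[of x] by simp
  qed
  then show False using nonzero f(4) by blast
qed

text \<open>Products of linear forms vanishing at \<open>P\<close> lie in \<open>I(P)\<^sup>2\<close> by construction, so a list of pairs of
  linear forms certifies a positive cone dimension once its sum of products vanishes on \<open>Z\<close> and
  is nonzero at some \<open>x\<close>.\<close>

lemma cone_of_linear_forms:
  assumes P: "ray P = vec.span {p}"
    and us: "\<And>c d. (c, d) \<in> set us \<Longrightarrow> dual c p = 0 \<and> dual d p = 0"
    and Z: "\<And>i s. i \<noteq> 4 \<Longrightarrow> s\<^sup>2 = 1 \<Longrightarrow>
      (\<Sum>(c, d)\<leftarrow>us. dual c (b i + s *s b 4) * dual d (b i + s *s b 4)) = 0"
    and x: "(\<Sum>(c, d)\<leftarrow>us. dual c x * dual d x) \<noteq> 0"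
  shows "cone_dim Z P > 0"
proof -
  define f where "f = (\<Sum>(c, d)\<leftarrow>us. linear_form c * linear_form d)"
  have f: "peval f y = (\<Sum>(c, d)\<leftarrow>us. dual c y * dual d y)" for y
    unfolding f_def by (induction us) (auto simp: peval_add peval_mult)
  have "homogeneous 2 f"
    unfolding f_def
    by (induction us) (auto intro: homogeneous_zero homogeneous_add homogeneous_linear_form_mult)
  moreover have "f \<noteq> 0" using x f[of x] by auto
  moreover have "f \<in> vanishing_ideal Z"
    unfolding vanishing_ideal_def
  proof (intro CollectI ballI)
    fix z y assume "z \<in> Z" "y \<in> ray z"
    then obtain i s k where i: "i \<noteq> 4" "s\<^sup>2 = 1" and y: "y = k *s (b i + s *s b 4)"
      using mem_Z_cases mem_span_singleton by metis
    have "peval f (k *s w) = k\<^sup>2 * (\<Sum>(c, d)\<leftarrow>us. dual c w * dual d w)" for w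
      unfolding f by (induction us) (auto simp: algebra_simps power2_eq_square)
    then show "peval f y = 0" unfolding y by (simp only: Z[OF i] mult_zero_right)
  qed
  moreover have "f \<in> ideal_mult (vanishing_ideal {P}) (vanishing_ideal {P})"
  proof -
    have "linear_form c \<in> vanishing_ideal {P}" if "dual c p = 0" for c
      using that P by (auto simp: vanishing_ideal_def mem_span_singleton)
    then have "set (map (\<lambda>(c, d). (linear_form c, linear_form d)) us) \<subseteq>
        vanishing_ideal {P} \<times> vanishing_ideal {P}"
      using us by auto
    from ideal_mult_list[OF this] show ?thesis
      by (simp add: f_def comp_def case_prod_unfold)
  qed
  ultimately show ?thesis unfolding cone_dim_pos_iff by blast
qed

text \<open>A combination of \<open>x\<^sub>1 x\<^sub>2, x\<^sub>1 x\<^sub>3, x\<^sub>2 x\<^sub>3\<close> vanishes on all of \<open>Z\<close>, because at each of the six points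
  only one of \<open>x\<^sub>1, x\<^sub>2, x\<^sub>3\<close> is nonzero. Such a cone is \<open>x\<^sub>k\<close> times the linear form in the other
  two coordinates \<open>x\<^sub>i, x\<^sub>j\<close> that vanishes at \<open>P\<close>. At the common point of the three lines that
  form would be zero, and the cone is \<open>x\<^sub>i x\<^sub>j\<close> instead.\<close>

lemma cone_dim_on_face_through_vertex:
  assumes P: "ray P = vec.span {p}" and k: "k \<noteq> 4" "dual (\<phi> k) p = 0"
  shows "cone_dim Z P > 0"
proof -
  obtain i j where ij: "i \<noteq> 4" "j \<noteq> 4" "i \<noteq> j" "i \<noteq> k" "j \<noteq> k"
    using k(1) exhaust_4[of k] distinct_4 by metis
  have ne [simp]: "i \<noteq> 4" "j \<noteq> 4" "k \<noteq> 4" "4 \<noteq> i" "4 \<noteq> j" "4 \<noteq> k"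
    "i \<noteq> j" "j \<noteq> i" "i \<noteq> k" "k \<noteq> i" "j \<noteq> k" "k \<noteq> j"
    using ij k(1) by auto
  show ?thesis
  proof (cases "dual (\<phi> i) p = 0 \<and> dual (\<phi> j) p = 0")
    case True
    show ?thesis
      by (rule cone_of_linear_forms[OF P, of "[(\<phi> i, \<phi> j)]" "b i + b j"])
        (use True in \<open>auto simp: dual_basis\<close>)
  next
    case False
    let ?u = "dual (\<phi> j) p *s \<phi> i - dual (\<phi> i) p *s \<phi> j"
    from False consider "dual (\<phi> j) p \<noteq> 0" | "dual (\<phi> i) p \<noteq> 0" by blast
    then obtain x where "dual (\<phi> k) x * dual ?u x \<noteq> 0"
    proof cases
      case 1
      then show ?thesis using that[of "b k + b i"] by (simp add: dual_basis)
    next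
      case 2
      then show ?thesis using that[of "b k + b j"] by (simp add: dual_basis)
    qed
    then show ?thesis
      by (intro cone_of_linear_forms[OF P, of "[(\<phi> k, ?u)]" x])
        (use k in \<open>auto simp: dual_basis\<close>)
  qed
qed

text \<open>With \<open>p = (p\<^sub>1, p\<^sub>2, p\<^sub>3, 0)\<close> and \<open>u\<^sub>i\<^sub>j = p\<^sub>i x\<^sub>j - p\<^sub>j x\<^sub>i\<close>, the form
  \<open>p\<^sub>3 u\<^sub>2\<^sub>3 u\<^sub>3\<^sub>1 + p\<^sub>1 u\<^sub>3\<^sub>1 u\<^sub>1\<^sub>2 + p\<^sub>2 u\<^sub>1\<^sub>2 u\<^sub>2\<^sub>3\<close> has the same coefficient \<open>- p\<^sub>1 p\<^sub>2 p\<^sub>3\<close> at each of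
  \<open>x\<^sub>1\<^sup>2, x\<^sub>2\<^sup>2, x\<^sub>3\<^sup>2\<close>. Adding \<open>p\<^sub>1 p\<^sub>2 p\<^sub>3 x\<^sub>4\<^sup>2\<close>, whose factor \<open>x\<^sub>4\<close> vanishes at \<open>p\<close> as well, therefore
  makes it vanish at all \<open>b i \<plusminus> b 4\<close>.\<close>

lemma cone_dim_on_harmonic_face:
  assumes P: "ray P = vec.span {p}" and "dual (\<phi> 4) p = 0" "\<And>k. k \<noteq> 4 \<Longrightarrow> dual (\<phi> k) p \<noteq> 0"
  shows "cone_dim Z P > 0"
proof -
  let ?x = "\<lambda>j. dual (\<phi> j) p"
  let ?u = "\<lambda>i j. ?x i *s \<phi> j - ?x j *s \<phi> i"
  let ?us = "[(?x 3 *s ?u 2 3, ?u 3 1), (?x 1 *s ?u 3 1, ?u 1 2), (?x 2 *s ?u 1 2, ?u 2 3),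
    ((?x 1 * ?x 2 * ?x 3) *s \<phi> 4, \<phi> 4)]"
  show ?thesis
  proof (rule cone_of_linear_forms[OF P, of ?us "b 4"])
    show "dual c p = 0 \<and> dual d p = 0" if "(c, d) \<in> set ?us" for c d
      using that assms(2) by auto
    show "(\<Sum>(c, d)\<leftarrow>?us. dual c (b i + s *s b 4) * dual d (b i + s *s b 4)) = 0"
      if "i \<noteq> 4" "s\<^sup>2 = 1" for i s
      using that exhaust_4[of i] by (auto simp: dual_basis algebra_simps power2_eq_square)
    show "(\<Sum>(c, d)\<leftarrow>?us. dual c (b 4) * dual d (b 4)) \<noteq> 0"
      using assms(3) by (simp add: dual_basis)
  qed
qed

lemma cone_dim_pos_iff_on_face: "cone_dim Z P > 0 \<longleftrightarrow> P \<in> (\<Union>k. face k)"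
proof -
  obtain p where P: "ray P = vec.span {p}" by (rule ray_generator)
  have "cone_dim Z P > 0 \<longleftrightarrow> (\<exists>k. dual (\<phi> k) p = 0)"
    using cone_dim_off_faces[OF P] cone_dim_on_face_through_vertex[OF P]
      cone_dim_on_harmonic_face[OF P] by (metis less_irrefl)
  then show ?thesis by (simp add: mem_face[OF P])
qed

lemma face_complement_not_empty: "\<exists>P. P \<notin> Z \<and> P \<notin> (\<Union>k. face k)"
proof -
  define p where "p = b 1 + b 2 + b 3 + b 4"
  have p: "dual (\<phi> k) p = 1" for k
    using exhaust_4[of k] by (auto simp: p_def dual_basis)
  then have "p \<noteq> 0" using nonzero_of_dual[of "\<phi> 1"] by simp
  then obtain P where P: "ray P = vec.span {p}" by (rule point_through)
  then have "P \<notin> (\<Union>k. face k)" using p by (simp add: mem_face)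
  moreover have "P \<notin> Z"
  proof
    assume "P \<in> Z"
    then obtain i s where "i \<noteq> 4" "s\<^sup>2 = 1" and r: "ray P = vec.span {b i + s *s b 4}"
      by (rule mem_Z_cases)
    obtain j where "j \<noteq> 4" "j \<noteq> i" using exhaust_4[of i] distinct_4 by metis
    then have "P \<in> face j" by (simp add: mem_face[OF r] dual_basis)
    with \<open>P \<notin> (\<Union>k. face k)\<close> show False by blast
  qed
  ultimately show ?thesis by blast
qed

lemma min_cone_dim: "(INF Q\<in>UNIV - Z. cone_dim Z Q) = 0"
proof -
  obtain P where "P \<notin> Z" "P \<notin> (\<Union>k. face k)" using face_complement_not_empty by blast
  then have "P \<in> UNIV - Z" "cone_dim Z P = 0" using cone_dim_pos_iff_on_face[of P] by auto
  then have "(INF Q\<in>UNIV - Z. cone_dim Z Q) \<le> 0"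
    using cINF_lower[of "cone_dim Z" "UNIV - Z" P] by (simp add: bdd_below_def)
  then show ?thesis by simp
qed

section \<open>The Weddle locus\<close>

text \<open>The union of the planes is closed, being the zero locus of the product of the four coordinate
  forms. Conversely, a point of \<open>Z\<close> spanned by \<open>b i \<plusminus> b 4\<close> is approached by the points
  \<open>b i \<plusminus> b 4 + t b j\<close> with \<open>t \<noteq> 0\<close>, which stay in the plane \<open>x\<^sub>k = 0\<close> for the third index \<open>k\<close>
  and avoid \<open>Z\<close>, since both their \<open>i\<close>- and their \<open>j\<close>-coordinate are nonzero.\<close>

lemma closure_faces_minus_Z: "zariski_closure ((\<Union>k. face k) - Z) = (\<Union>k. face k)"
proof
  show "zariski_closure ((\<Union>k. face k) - Z) \<subseteq> (\<Union>k. face k)"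
  proof
    fix P assume P: "P \<in> zariski_closure ((\<Union>k. face k) - Z)"
    obtain p where p: "ray P = vec.span {p}" by (rule ray_generator)
    define F where "F = linear_form (\<phi> 1) * linear_form (\<phi> 2) * linear_form (\<phi> 3) * linear_form (\<phi> 4)"
    have F: "peval F x = 0 \<longleftrightarrow> (\<exists>k. dual (\<phi> k) x = 0)" for x
    proof -
      have "(\<exists>k. dual (\<phi> k) x = 0) \<longleftrightarrow> dual (\<phi> 1) x = 0 \<or> dual (\<phi> 2) x = 0 \<or>
          dual (\<phi> 3) x = 0 \<or> dual (\<phi> 4) x = 0"
        using exhaust_4 by metis
      then show ?thesis by (simp add: F_def peval_mult)
    qed
    have "F \<in> vanishing_ideal ((\<Union>k. face k) - Z)"
      unfolding vanishing_ideal_def using F by (auto simp: face_def simp del: not_ex)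
    then have "peval F p = 0"
      using P p by (auto simp: zariski_closure_def zero_locus_def vec.span_base)
    then show "P \<in> (\<Union>k. face k)"
      by (simp add: F mem_face[OF p])
  qed
  show "(\<Union>k. face k) \<subseteq> zariski_closure ((\<Union>k. face k) - Z)"
    unfolding zariski_closure_def zero_locus_def
  proof (intro subsetI CollectI ballI)
    fix P f x
    assume P: "P \<in> (\<Union>k. face k)" and f: "f \<in> vanishing_ideal ((\<Union>k. face k) - Z)" and x: "x \<in> ray P"
    show "peval f x = 0"
    proof (cases "P \<in> Z")
      case False
      then show ?thesis using P f x by (auto simp: vanishing_ideal_def)
    next
      case True
      then obtain i s where i: "i \<noteq> 4" and r: "ray P = vec.span {b i + s *s b 4}"
        by (rule mem_Z_cases)
      obtain j k where jk: "j \<noteq> i" "j \<noteq> 4" "k \<noteq> i" "k \<noteq> 4" "j \<noteq> k"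
        using i exhaust_4[of i] distinct_4 by metis
      obtain l where l: "x = l *s (b i + s *s b 4)"
        using x r by (auto simp: mem_span_singleton)
      obtain q where q: "\<And>t. peval f (x + t *s (l *s b j)) = poly q t"
        using peval_along_line by blast
      have "poly q t = 0" if "t \<noteq> 0" for t
      proof -
        let ?y = "b i + s *s b 4 + t *s b j"
        have "dual (\<phi> j) ?y = t" using jk by (simp add: dual_basis)
        then have "?y \<noteq> 0" using \<open>t \<noteq> 0\<close> nonzero_of_dual by metis
        then obtain R where R: "ray R = vec.span {?y}" by (rule point_through)
        have "R \<in> face k" using jk by (simp add: mem_face[OF R] dual_basis)
        moreover have "R \<notin> Z"
        proof
          assume "R \<in> Z"
          then obtain m s' where m: "m \<noteq> 4" "ray R = vec.span {b m + s' *s b 4}"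
            by (rule mem_Z_cases)
          have "R \<in> face i \<or> R \<in> face j"
            using m jk i by (auto simp: mem_face[OF m(2)] dual_basis)
          then show False
            using jk i \<open>t \<noteq> 0\<close> by (auto simp: mem_face[OF R] dual_basis)
        qed
        moreover have "x + t *s (l *s b j) \<in> ray R"
          unfolding R mem_span_singleton l
          by (rule exI[of _ l]) (simp add: vec_eq_iff algebra_simps)
        ultimately have "peval f (x + t *s (l *s b j)) = 0"
          using f by (auto simp: vanishing_ideal_def)
        then show ?thesis unfolding q .
      qed
      then have "UNIV - {0} \<subseteq> {t. poly q t = 0}" by auto
      then have "infinite {t. poly q t = 0}"
        using infinite_UNIV_char_0[where 'a = complex] by (meson finite.emptyI finite_Diff2 finite_insert finite_subset)
      then have "q = 0" using poly_roots_finite by blast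
      then show ?thesis using q[of 0] by simp
    qed
  qed
qed

lemma weddle_locus_eq_faces: "weddle_locus Z = (\<Union>k. face k)"
proof -
  have "{P \<in> UNIV - Z. cone_dim Z P > (INF Q\<in>UNIV - Z. cone_dim Z Q)} = (\<Union>k. face k) - Z"
    unfolding min_cone_dim cone_dim_pos_iff_on_face by blast
  then show ?thesis
    unfolding weddle_locus_def by (simp only: closure_faces_minus_Z)
qed

end

theorem proposition4p13:
  fixes L :: "nat \<Rightarrow> proj3 set" and P Q H :: "nat \<Rightarrow> proj3" and pO :: proj3
    and Z :: "proj3 set"
  assumes lines: "\<forall>i\<in>{1, 2, 3}. is_line (L i)"
    and noncoplanar: "\<not> (\<exists>E. is_plane E \<and> L 1 \<union> L 2 \<union> L 3 \<subseteq> E)"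
    and concurrent: "\<forall>i\<in>{1, 2, 3}. pO \<in> L i"
    and Z_def: "Z = {P 1, P 2, P 3, Q 1, Q 2, Q 3}"
    and six_points: "card Z = 6"
    and not_vertex: "Z \<subseteq> UNIV - {pO}"
    and on_lines: "\<forall>i\<in>{1, 2, 3}. P i \<in> L i \<and> Q i \<in> L i"
    and harmonic: "\<forall>i\<in>{1, 2, 3}. H i \<in> L i \<and> harmonic_conjugate (H i) pO (P i) (Q i)"
  shows "is_plane (lin_span (L 1 \<union> L 2)) \<and> is_plane (lin_span (L 1 \<union> L 3)) \<and>
         is_plane (lin_span (L 2 \<union> L 3)) \<and> is_plane (lin_span {H 1, H 2, H 3}) \<and>
         weddle_locus Z =
           lin_span (L 1 \<union> L 2) \<union> lin_span (L 1 \<union> L 3) \<union> lin_span (L 2 \<union> L 3)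
             \<union> lin_span {H 1, H 2, H 3}"
proof -
  have PQ: "P i \<noteq> Q i" if "i \<in> {1, 2, 3}" for i
  proof
    assume eq: "P i = Q i"
    have "card Z \<le> 5"
      using that eq unfolding Z_def by (auto simp: card_insert_if)
    then show False using six_points by simp
  qed
  obtain e where e: "ray pO = vec.span {e}" "e \<noteq> 0" by (metis ray_generator)
  have "\<exists>h. ray (H i) = vec.span {h} \<and> ray (P i) = vec.span {h + e} \<and> ray (Q i) = vec.span {h - e}"
    if "i \<in> {1, 2, 3}" for i
    using harmonic_representatives[OF _ PQ[OF that] e, of "H i"] harmonic that by metis
  then obtain h where h: "\<And>i. i \<in> {1, 2, 3} \<Longrightarrow> ray (H i) = vec.span {h i}"
    "\<And>i. i \<in> {1, 2, 3} \<Longrightarrow> ray (P i) = vec.span {h i + e}"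
    "\<And>i. i \<in> {1, 2, 3} \<Longrightarrow> ray (Q i) = vec.span {h i - e}"
    by metis
  have L: "L i = {r. ray r \<subseteq> vec.span {e, h i}}" if i: "i \<in> {1, 2, 3}" for i
  proof -
    have "pO \<noteq> P i" using not_vertex i unfolding Z_def by auto
    then have "L i = {r. ray r \<subseteq> vec.span {e, h i + e}}"
      using line_eq_span[OF _ _ _ _ e(1) h(2)[OF i]] lines concurrent on_lines i by blast
    moreover have "vec.span {e, h i + e} = vec.span {e, h i}"
    proof (rule vec.span_eq[THEN iffD2], intro conjI)
      show "{e, h i + e} \<subseteq> vec.span {e, h i}"
        by (simp add: vec.span_base vec.span_add)
      have "(h i + e) - e \<in> vec.span {e, h i + e}"
        by (intro vec.span_diff vec.span_base) simp_all
      then show "{e, h i} \<subseteq> vec.span {e, h i + e}"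
        by (simp add: vec.span_base)
    qed
    ultimately show ?thesis by simp
  qed
  define b :: "4 \<Rightarrow> complex ^ 4" where
    "b j = (if j = 1 then h 1 else if j = 2 then h 2 else if j = 3 then h 3 else e)" for j
  have b: "b 1 = h 1" "b 2 = h 2" "b 3 = h 3" "b 4 = e" by (simp_all add: b_def)
  have "vec.span (range b) = UNIV"
  proof (rule ccontr)
    assume ne: "vec.span (range b) \<noteq> UNIV"
    have "vec.dim (vec.span (range b)) \<noteq> 4"
      using ne vec.subspace_dim_equal[OF vec.subspace_span vec.subspace_UNIV subset_UNIV, of "range b"]
      by (metis dim_UNIV_4 order_refl)
    moreover have "vec.dim (vec.span (range b)) \<le> 4"
      using vec.dim_subset[of "vec.span (range b)" UNIV] dim_UNIV_4 by (simp del: vec.dim_UNIV)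
    ultimately have "vec.dim (vec.span (range b)) \<le> 3" by linarith
    then obtain W where W: "vec.subspace W" "vec.dim W = 3" "vec.span (range b) \<subseteq> W"
      using subspace_of_dim_3[OF vec.subspace_span] by blast
    have "is_plane {r. ray r \<subseteq> W}"
      unfolding proj_subspace_def by (intro exI[of _ W]) (simp add: W)
    moreover have "L 1 \<union> L 2 \<union> L 3 \<subseteq> {r. ray r \<subseteq> W}"
    proof -
      have "b j \<in> W" for j using W(3) vec.span_base[of "b j" "range b"] by blast
      then have "vec.span {e, h 1} \<subseteq> W" "vec.span {e, h 2} \<subseteq> W" "vec.span {e, h 3} \<subseteq> W"
        using W(1) b vec.span_minimal by (metis empty_subsetI insert_subset)+
      then show ?thesis by (auto simp: L)
    qed
    ultimately show False using noncoplanar by blast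
  qed
  then obtain \<phi> where "frame b \<phi>" by (rule frame_of_spanning)
  then interpret frame b \<phi> .
  interpret symmetric_six b \<phi> Z
  proof
    fix p
    have "p \<in> Z \<longleftrightarrow> (\<exists>i\<in>{1, 2, 3}. ray p = ray (P i) \<or> ray p = ray (Q i))"
      unfolding Z_def ray_inject by auto
    also have "\<dots> \<longleftrightarrow> (\<exists>i\<in>{1, 2, 3}. ray p = vec.span {h i + e} \<or> ray p = vec.span {h i - e})"
      by (rule bex_cong[OF refl]) (simp only: h)
    also have "\<dots> \<longleftrightarrow> (\<exists>i. i \<noteq> 4 \<and> (ray p = vec.span {b i + e} \<or> ray p = vec.span {b i - e}))"
    proof -
      have "(\<exists>i. i \<noteq> 4 \<and> F i) \<longleftrightarrow> F 1 \<or> F 2 \<or> F 3" for F :: "4 \<Rightarrow> bool"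
        using exhaust_4 distinct_4 by metis
      then show ?thesis by (simp only: b bex_simps simp_thms)
    qed
    also have "\<dots> \<longleftrightarrow> (\<exists>i s. i \<noteq> 4 \<and> s\<^sup>2 = 1 \<and> ray p = vec.span {b i + s *s b 4})"
    proof -
      have "b i + 1 *s b 4 = b i + e" "b i + (-1) *s b 4 = b i - e" for i
        by (simp_all add: b vec_eq_iff)
      moreover have "(\<exists>s. s\<^sup>2 = 1 \<and> F s) \<longleftrightarrow> F 1 \<or> F (-1)" for F :: "complex \<Rightarrow> bool"
        unfolding power2_eq_1_iff by blast
      ultimately show ?thesis by (simp only: ex_simps)
    qed
    finally show "p \<in> Z \<longleftrightarrow> (\<exists>i s. i \<noteq> 4 \<and> s\<^sup>2 = 1 \<and> ray p = vec.span {b i + s *s b 4})" .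
  qed
  have reps: "b 1 \<in> ray (H 1)" "b 2 \<in> ray (H 2)" "b 3 \<in> ray (H 3)"
    by (simp_all add: b h vec.span_base)
  have complement: "b ` {j. j \<noteq> 1} = {b 2, b 3, b 4}" "b ` {j. j \<noteq> 2} = {b 1, b 3, b 4}"
    "b ` {j. j \<noteq> 3} = {b 1, b 2, b 4}" "b ` {j. j \<noteq> 4} = {b 1, b 2, b 3}"
  proof -
    have "{j::4. j \<noteq> 1} = {2, 3, 4}" "{j::4. j \<noteq> 2} = {1, 3, 4}"
      "{j::4. j \<noteq> 3} = {1, 2, 4}" "{j::4. j \<noteq> 4} = {1, 2, 3}"
      using exhaust_4 by auto
    then show "b ` {j. j \<noteq> 1} = {b 2, b 3, b 4}" "b ` {j. j \<noteq> 2} = {b 1, b 3, b 4}"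
      "b ` {j. j \<noteq> 3} = {b 1, b 2, b 4}" "b ` {j. j \<noteq> 4} = {b 1, b 2, b 3}"
      by simp_all
  qed
  have two_lines: "vec.span (\<Union>q\<in>L i \<union> L j. ray q) = vec.span {h i, h j, e}"
    if ij: "i \<in> {1, 2, 3}" "j \<in> {1, 2, 3}" for i j
  proof (rule vec.span_eq[THEN iffD2], intro conjI)
    have "vec.span {e, h i} \<subseteq> vec.span {h i, h j, e}" "vec.span {e, h j} \<subseteq> vec.span {h i, h j, e}"
      by (intro vec.span_mono; blast)+
    then show "(\<Union>q\<in>L i \<union> L j. ray q) \<subseteq> vec.span {h i, h j, e}"
      using L[OF ij(1)] L[OF ij(2)] by blast
    have "h i \<in> ray (H i)" "h j \<in> ray (H j)" "e \<in> ray pO"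
      using h(1) ij e(1) by (simp_all add: vec.span_base)
    then have "{h i, h j, e} \<subseteq> (\<Union>q\<in>L i \<union> L j. ray q)"
      using harmonic concurrent ij by blast
    then show "{h i, h j, e} \<subseteq> vec.span (\<Union>q\<in>L i \<union> L j. ray q)"
      using vec.span_superset by blast
  qed
  have spans: "vec.span (\<Union>q\<in>L 1 \<union> L 2. ray q) = vec.span (b ` {j. j \<noteq> 3})"
    "vec.span (\<Union>q\<in>L 1 \<union> L 3. ray q) = vec.span (b ` {j. j \<noteq> 2})"
    "vec.span (\<Union>q\<in>L 2 \<union> L 3. ray q) = vec.span (b ` {j. j \<noteq> 1})"
    unfolding complement b by (rule two_lines; simp)+
  have harmonic_span: "vec.span (\<Union>q\<in>{H 1, H 2, H 3}. ray q) = vec.span (b ` {j. j \<noteq> 4})"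
    unfolding complement
  proof (rule vec.span_eq[THEN iffD2], intro conjI)
    have "ray (H i) \<subseteq> vec.span {b 1, b 2, b 3}" if i: "i \<in> {1, 2, 3}" for i
    proof -
      have "{h i} \<subseteq> {b 1, b 2, b 3}" using i b by auto
      then show ?thesis unfolding h(1)[OF i] by (rule vec.span_mono)
    qed
    then show "(\<Union>q\<in>{H 1, H 2, H 3}. ray q) \<subseteq> vec.span {b 1, b 2, b 3}" by blast
    have "{b 1, b 2, b 3} \<subseteq> (\<Union>q\<in>{H 1, H 2, H 3}. ray q)" using reps by blast
    then show "{b 1, b 2, b 3} \<subseteq> vec.span (\<Union>q\<in>{H 1, H 2, H 3}. ray q)"
      using vec.span_superset by blast
  qed
  have "(\<Union>k. face k) = face 3 \<union> face 2 \<union> face 1 \<union> face 4"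
    by (auto simp: UNIV_4)
  then show ?thesis
    using weddle_locus_eq_faces lin_span_eq_face[OF spans(1)] lin_span_eq_face[OF spans(2)]
      lin_span_eq_face[OF spans(3)] lin_span_eq_face[OF harmonic_span] by simp
qed

end
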